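(* Let $E\subset\mathbb{R}$ be nonempty, compact, perfect, and nowhere dense, and let $F\subset\mathbb{R}$ be a dense subfield. Then there exists a function $g\in C_c^\infty(\mathbb{R})$ such that: (i) for every connected component $I$ of $\mathbb{R}\setminus E$, there exists a polynomial $P_I\in F[x]$ such that $g|_I=P_I|_I$; (ii) $g$ is real-analytic on $\mathbb{R}\setminus E$; (iii) $g$ is not real-analytic at any point of $E$. Consequently, $\operatorname{NA}(g)=E$.
   Context: $C_c^\infty(\mathbb{R})$ is the space of real-valued compactly supported $C^\infty$ functions on $\mathbb{R}$. $\operatorname{NA}(u)$ denotes the set of points at which the function $u$ is not real-analytic (a function is real-analytic at a point if it is given by a convergent power series in a neighborhood of that point). A perfect set is a closed set without isolated points. *)

theory Defs
  imports "HOL-Analysis.Analysis" "HOL-Computational_Algebra.Polynomial"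
begin

text \<open>
  If all iterated derivatives are differentiable everywhere, then each \<^term>\<open>(deriv ^^ n) f\<close>
  is the genuine (and continuous) $n$-th derivative, so this is $C^\infty$ in the usual sense.
\<close>
definition smooth :: "(real \<Rightarrow> real) \<Rightarrow> bool" where
  "smooth f \<longleftrightarrow> (\<forall>n x. (deriv ^^ n) f differentiable (at x))"

definition Cc_infinity :: "(real \<Rightarrow> real) set" where
  "Cc_infinity = {f. smooth f \<and> compact (closure {x. f x \<noteq> 0})}"

text \<open>
  \<^const>\<open>has_fps_expansion\<close> refers to expansions at $0$, hence the shift. It requires a positive
  radius of convergence and agreement with the sum of the series on a neighbourhood.
\<close>
definition real_analytic_at :: "(real \<Rightarrow> real) \<Rightarrow> real \<Rightarrow> bool" where
  "real_analytic_at f x \<longleftrightarrow> (\<exists>A. (\<lambda>h. f (x + h)) has_fps_expansion A)"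

definition NA :: "(real \<Rightarrow> real) \<Rightarrow> real set" where
  "NA f = {x. \<not> real_analytic_at f x}"

definition perfect :: "'a::topological_space set \<Rightarrow> bool" where
  "perfect S \<longleftrightarrow> closed S \<and> \<not> (\<exists>x. x isolated_in S)"

definition nowhere_dense :: "'a::topological_space set \<Rightarrow> bool" where
  "nowhere_dense S \<longleftrightarrow> interior (closure S) = {}"

definition subfield_of_reals :: "real set \<Rightarrow> bool" where
  "subfield_of_reals F \<longleftrightarrow> 0 \<in> F \<and> 1 \<in> F \<and>
     (\<forall>x\<in>F. \<forall>y\<in>F. x + y \<in> F \<and> x * y \<in> F) \<and>
     (\<forall>x\<in>F. - x \<in> F) \<and> (\<forall>x\<in>F. x \<noteq> 0 \<longrightarrow> inverse x \<in> F)"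

definition polys_over :: "real set \<Rightarrow> real poly set" where
  "polys_over F = {p. \<forall>i. coeff p i \<in> F}"

end

theory Submission
  imports Defs "HOL-Complex_Analysis.Complex_Analysis"
begin

text \<open>
  Treat the bounded gaps $[a_n, b_n]$ of $E$ one after the other. They are pairwise disjoint and
  disjoint from the closures of the unbounded components, because $E$ has no isolated points. Given a
  smooth $g_n$ that is already polynomial on the earlier gaps, approximate it in $C^n$ near
  $[a_n, b_n]$ by a polynomial $P_n$ over $F$ of degree larger than all degrees used before, and set
  $g_{n+1} = g_n + u_n (P_n - g_n)$ with a cutoff $u_n$ that is $1$ on $[a_n, b_n]$ and vanishes on the
  earlier gaps. If the $n$-th correction is at most $2^{-n}$ in $C^n$, the limit $g$ is smooth
  and equals $P_n$ on the $n$-th gap.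

  Every neighbourhood of a point of $E$ contains two different gaps. If $g$ were analytic there, the
  identity theorem would force the two polynomials to agree, but they have different degrees.
\<close>

section \<open>Closure properties and derivatives of smooth functions\<close>

text \<open>Derivatives are unique, so \<open>deriv\<close> of a member coincides with the member
  that \<open>S\<close> provides, and all iterated derivatives stay in \<open>S\<close>. This proves
  smoothness of a whole family at once, without formulas for n-th derivatives.\<close>

lemma smooth_coinduct:
  assumes "f \<in> S" and S: "\<And>f. f \<in> S \<Longrightarrow> \<exists>f'\<in>S. \<forall>x. (f has_real_derivative f' x) (at x)"
  shows "smooth f"
proof -
  have "(deriv ^^ n) f \<in> S" for n
  proof (induction n)
    case (Suc n)
    then obtain f' where f': "f' \<in> S" "\<forall>x. ((deriv ^^ n) f has_real_derivative f' x) (at x)"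
      using S by blast
    then have "deriv ((deriv ^^ n) f) = f'"
      by (auto intro: DERIV_imp_deriv)
    then show ?case using f' by simp
  qed (use assms in auto)
  then show ?thesis
    unfolding smooth_def by (metis S real_differentiable_def)
qed

lemma smooth_has_deriv: "smooth f \<Longrightarrow> (f has_real_derivative deriv f x) (at x)"
  unfolding smooth_def by (metis DERIV_deriv_iff_real_differentiable funpow_0)

lemma smooth_deriv: "smooth f \<Longrightarrow> smooth (deriv f)"
  unfolding smooth_def by (metis funpow_Suc_right comp_apply)

lemma smooth_higher_deriv: "smooth f \<Longrightarrow> smooth ((deriv ^^ n) f)"
  by (induction n) (auto intro: smooth_deriv)

lemma smooth_continuous_on: "smooth f \<Longrightarrow> continuous_on A f"
  by (meson DERIV_isCont continuous_at_imp_continuous_on smooth_has_deriv)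

text \<open>
  The derivative of a member is again a member, so coinduction yields the closure properties of
  smooth functions all at once, without the Leibniz formula.
\<close>
inductive smooth_closure :: "(real \<Rightarrow> real) \<Rightarrow> bool" where
  base: "smooth f \<Longrightarrow> smooth_closure f"
| const: "smooth_closure (\<lambda>_. c)"
| ident: "smooth_closure (\<lambda>x. x)"
| add: "smooth_closure f \<Longrightarrow> smooth_closure g \<Longrightarrow> smooth_closure (\<lambda>x. f x + g x)"
| mult: "smooth_closure f \<Longrightarrow> smooth_closure g \<Longrightarrow> smooth_closure (\<lambda>x. f x * g x)"
| inverse: "smooth_closure f \<Longrightarrow> (\<And>x. f x \<noteq> 0) \<Longrightarrow> smooth_closure (\<lambda>x. inverse (f x))"
| affine: "smooth_closure f \<Longrightarrow> smooth_closure (\<lambda>x. f (c * x + d))"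

lemma smooth_closure_deriv:
  "smooth_closure f \<Longrightarrow> \<exists>f'. smooth_closure f' \<and> (\<forall>x. (f has_real_derivative f' x) (at x))"
proof (induction rule: smooth_closure.induct)
  case (base f)
  then show ?case
    by (meson smooth_closure.base smooth_deriv smooth_has_deriv)
next
  case (const c)
  then show ?case
    by (intro exI[of _ "\<lambda>_. 0"]) (auto intro: smooth_closure.const)
next
  case ident
  then show ?case
    by (intro exI[of _ "\<lambda>_. 1"]) (auto intro: smooth_closure.const)
next
  case (add f g)
  then obtain f' g' where "smooth_closure f'" "smooth_closure g'"
    "\<And>x. (f has_real_derivative f' x) (at x)" "\<And>x. (g has_real_derivative g' x) (at x)"
    by blast
  then show ?case
    by (intro exI[of _ "\<lambda>x. f' x + g' x"]) (auto intro!: smooth_closure.add DERIV_add)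
next
  case (mult f g)
  then obtain f' g' where "smooth_closure f'" "smooth_closure g'"
    "\<And>x. (f has_real_derivative f' x) (at x)" "\<And>x. (g has_real_derivative g' x) (at x)"
    by blast
  with mult show ?case
    by (intro exI[of _ "\<lambda>x. f' x * g x + g' x * f x"])
       (auto intro!: smooth_closure.add smooth_closure.mult DERIV_mult)
next
  case (inverse f)
  then obtain f' where "smooth_closure f'" and f': "\<And>x. (f has_real_derivative f' x) (at x)"
    by blast
  \<comment> \<open>The derivative -f'/f^2 is spelled out as a product in which only constructors of
    \<open>smooth_closure\<close> occur.\<close>
  with inverse have "smooth_closure (\<lambda>x. (-1) * (inverse (f x) * f' x * inverse (f x)))"
    by (intro smooth_closure.const smooth_closure.mult smooth_closure.inverse)
  moreover have "((\<lambda>x. inverse (f x)) has_real_derivative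
      (-1) * (inverse (f x) * f' x * inverse (f x))) (at x)" for x
    using DERIV_inverse'[OF f'] inverse by simp
  ultimately show ?case by blast
next
  case (affine f c d)
  then obtain f' where f': "smooth_closure f'" "\<And>x. (f has_real_derivative f' x) (at x)"
    by blast
  have "((\<lambda>x. f (c * x + d)) has_real_derivative f' (c * x + d) * c) (at x)" for x
    by (rule DERIV_chain2[OF f'(2)]) (auto intro!: derivative_eq_intros)
  with f' show ?case
    by (intro exI[of _ "\<lambda>x. f' (c * x + d) * c"])
       (auto intro!: smooth_closure.mult smooth_closure.const smooth_closure.affine)
qed

lemma smooth_closure_smooth: "smooth_closure f \<Longrightarrow> smooth f"
  by (rule smooth_coinduct[where S = "Collect smooth_closure"])
     (use smooth_closure_deriv in auto)

lemma smooth_const: "smooth (\<lambda>_. c)"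
  and smooth_ident: "smooth (\<lambda>x. x)"
  and smooth_add: "smooth f \<Longrightarrow> smooth g \<Longrightarrow> smooth (\<lambda>x. f x + g x)"
  and smooth_mult: "smooth f \<Longrightarrow> smooth g \<Longrightarrow> smooth (\<lambda>x. f x * g x)"
  and smooth_inverse: "smooth f \<Longrightarrow> (\<And>x. f x \<noteq> 0) \<Longrightarrow> smooth (\<lambda>x. inverse (f x))"
  and smooth_affine: "smooth f \<Longrightarrow> smooth (\<lambda>x. f (c * x + d))"
  by (auto intro!: smooth_closure_smooth intro: smooth_closure.intros)

lemma smooth_minus: "smooth f \<Longrightarrow> smooth (\<lambda>x. - f x)"
  using smooth_mult[OF smooth_const[of "-1"]] by fastforce

lemma smooth_diff: "smooth f \<Longrightarrow> smooth g \<Longrightarrow> smooth (\<lambda>x. f x - g x)"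
  using smooth_add[OF _ smooth_minus] by fastforce

lemma smooth_poly: "smooth (poly p)"
proof (induction p)
  case 0
  then show ?case by (simp add: smooth_const)
next
  case (pCons a p)
  have "poly (pCons a p) = (\<lambda>x. a + x * poly p x)" by (auto simp: fun_eq_iff)
  then show ?case
    by (simp only: smooth_add smooth_mult smooth_const smooth_ident pCons.IH)
qed

lemma deriv_smooth_add:
  "smooth f \<Longrightarrow> smooth g \<Longrightarrow> deriv (\<lambda>x. f x + g x) = (\<lambda>x. deriv f x + deriv g x)"
  by (auto intro!: DERIV_imp_deriv DERIV_add smooth_has_deriv)

lemma deriv_smooth_mult:
  "smooth f \<Longrightarrow> smooth g \<Longrightarrow> deriv (\<lambda>x. f x * g x) = (\<lambda>x. deriv f x * g x + f x * deriv g x)"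
  using DERIV_mult[OF smooth_has_deriv smooth_has_deriv, of f g]
  by (auto intro!: DERIV_imp_deriv simp: algebra_simps)

lemma funpow_Suc_deriv: "(deriv ^^ Suc n) f = (deriv ^^ n) (deriv f)"
  by (simp add: funpow_swap1)

lemma higher_deriv_smooth_add:
  "smooth f \<Longrightarrow> smooth g \<Longrightarrow>
    (deriv ^^ n) (\<lambda>x. f x + g x) = (\<lambda>x. (deriv ^^ n) f x + (deriv ^^ n) g x)"
  by (induction n) (simp_all add: deriv_smooth_add smooth_higher_deriv)

subsection \<open>Cutoff functions\<close>

text \<open>
  A family containing $e^{-1/x}$ and closed under differentiation.
\<close>
definition flat_exp :: "real poly \<Rightarrow> real \<Rightarrow> real" where
  "flat_exp p x = (if x > 0 then poly p (inverse x) * exp (- inverse x) else 0)"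

text \<open>The substitution y = 1/x reduces the right-hand limit to the decay of p(y) exp(-y) as y
  tends to infinity.\<close>

lemma flat_exp_tendsto_0: "(flat_exp p \<longlongrightarrow> 0) (at 0)"
proof -
  \<comment> \<open>The extra factor y^k makes the induction go through: the y in front of the tail
    of \<open>pCons a p\<close> is absorbed by raising k.\<close>
  have "((\<lambda>y. y ^ k * poly p y * exp (- y)) \<longlongrightarrow> 0) at_top" for k
  proof (induction p arbitrary: k)
    case (pCons a p)
    have "((\<lambda>y::real. a * (y ^ k / exp y) + y ^ Suc k * poly p y * exp (- y)) \<longlongrightarrow> a * 0 + 0) at_top"
      by (intro tendsto_add tendsto_mult tendsto_const tendsto_power_div_exp_0 pCons.IH)
    then show ?case
      by (simp add: algebra_simps exp_minus divide_inverse)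
  qed simp
  from this[of 0] have 1: "((\<lambda>y. poly p y * exp (- y)) \<longlongrightarrow> 0) at_top"
    by simp
  have 2: "((\<lambda>x. poly p (inverse x) * exp (- inverse x)) \<longlongrightarrow> 0) (at_right 0)"
    using filterlim_compose[OF 1 filterlim_inverse_at_top_right] .
  show ?thesis
    unfolding filterlim_at_split
  proof
    show "(flat_exp p \<longlongrightarrow> 0) (at_left 0)"
      by (rule tendsto_eventually) (auto simp: eventually_at_filter flat_exp_def)
    show "(flat_exp p \<longlongrightarrow> 0) (at_right 0)"
      by (rule Lim_transform_eventually[OF 2])
         (auto simp: eventually_at_filter flat_exp_def)
  qed
qed

text \<open>With y = 1/x one has dy/dx = -y^2, so p(y) exp(-y) has derivative y^2 (p(y) - p'(y))
  exp(-y); the polynomial \<open>[:0, 0, 1:]\<close> is the factor y^2.\<close>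

lemma flat_exp_deriv:
  "(flat_exp p has_real_derivative flat_exp ([:0, 0, 1:] * (p - pderiv p)) x) (at x)"
proof (cases x "0::real" rule: linorder_cases)
  case less
  have "((\<lambda>x. 0) has_real_derivative 0) (at x)" by simp
  moreover have "\<forall>\<^sub>F y in nhds x. flat_exp p y = 0"
    using eventually_nhds_in_open[of "{..<0}" x] less
    by (auto elim!: eventually_mono simp: flat_exp_def)
  ultimately show ?thesis
    using less by (subst DERIV_cong_ev[OF refl _ refl]) (auto simp: flat_exp_def)
next
  case greater
  have "\<forall>\<^sub>F y in nhds x. flat_exp p y = poly p (inverse y) * exp (- inverse y)"
    using eventually_nhds_in_open[of "{0<..}" x] greater
    by (auto elim!: eventually_mono simp: flat_exp_def)
  moreover have "((\<lambda>y. poly p (inverse y) * exp (- inverse y)) has_real_derivative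
      flat_exp ([:0, 0, 1:] * (p - pderiv p)) x) (at x)"
    using greater
    by (auto intro!: derivative_eq_intros DERIV_chain2[OF poly_DERIV]
        simp: flat_exp_def field_simps power2_eq_square)
  ultimately show ?thesis
    by (subst DERIV_cong_ev[OF refl _ refl])
next
  case equal
  \<comment> \<open>Dividing by h multiplies by y = 1/h, so the difference quotient at 0 is again a
    function of the family and tends to 0.\<close>
  have "((\<lambda>h. (flat_exp p (0 + h) - flat_exp p 0) / h) \<longlongrightarrow> 0) (at 0)"
  proof (rule Lim_transform_eventually[OF flat_exp_tendsto_0[of "[:0, 1:] * p"]])
    show "\<forall>\<^sub>F h in at 0. flat_exp ([:0, 1:] * p) h = (flat_exp p (0 + h) - flat_exp p 0) / h"
      by (auto simp: flat_exp_def field_simps eventually_at_filter)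
  qed
  with equal show ?thesis by (auto simp: DERIV_def flat_exp_def)
qed

lemma smooth_flat_exp: "smooth (flat_exp p)"
  by (rule smooth_coinduct[where S = "range flat_exp"]) (use flat_exp_deriv in blast)+

lemma smooth_step:
  obtains s where "smooth s" "\<And>x. x \<le> 0 \<Longrightarrow> s x = 0" "\<And>x. x \<ge> 1 \<Longrightarrow> s x = 1"
proof
  let ?f = "flat_exp 1"
  \<comment> \<open>The usual quotient f(x) / (f(x) + f(1 - x)). Its denominator is positive because
    x or 1 - x is positive. The argument 1 - x is written in the shape that
    \<open>smooth_affine\<close> expects.\<close>
  let ?s = "\<lambda>x. ?f x * inverse (?f x + ?f (- 1 * x + 1))"
  have pos: "?f x + ?f (- 1 * x + 1) \<noteq> 0" for x
  proof -
    have "?f x \<ge> 0" "?f (- 1 * x + 1) \<ge> 0" "?f x > 0 \<or> ?f (- 1 * x + 1) > 0"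
      by (auto simp: flat_exp_def)
    then show ?thesis by linarith
  qed
  show "smooth ?s"
    using pos by (intro smooth_mult smooth_inverse smooth_add smooth_affine smooth_flat_exp)
  show "?s x = 0" if "x \<le> 0" for x
    using that by (simp add: flat_exp_def)
  show "?s x = 1" if "x \<ge> 1" for x
    using that by (simp add: flat_exp_def)
qed

lemma smooth_cutoff:
  assumes "A < a" "a \<le> b" "b < B"
  obtains u where "smooth u" "\<And>x. x \<in> {a..b} \<Longrightarrow> u x = 1" "\<And>x. x \<notin> {A<..<B} \<Longrightarrow> u x = 0"
proof -
  obtain s where s: "smooth s" "\<And>x. x \<le> 0 \<Longrightarrow> s x = 0" "\<And>x. x \<ge> 1 \<Longrightarrow> s x = 1"
    using smooth_step by blast
  \<comment> \<open>A step rising on [A, a] times a step falling on [b, B].\<close>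
  let ?u = "\<lambda>x. s (1 / (a - A) * x + - A / (a - A)) * s (- 1 / (B - b) * x + B / (B - b))"
  have eq: "?u x = s ((x - A) / (a - A)) * s ((B - x) / (B - b))" for x
    by (simp add: diff_divide_distrib algebra_simps)
  show ?thesis
  proof
    show "smooth ?u" by (intro smooth_mult smooth_affine s)
    show "?u x = 1" if "x \<in> {a..b}" for x
      unfolding eq using that assms by (simp add: s(3))
    show "?u x = 0" if "x \<notin> {A<..<B}" for x
      unfolding eq using that assms by (cases "x \<le> A") (simp_all add: s(2) divide_nonpos_pos)
  qed
qed

section \<open>Local vanishing and bounds for higher derivatives\<close>

lemma higher_deriv_zero_open:
  assumes "open U" "x \<in> U" "\<And>y. y \<in> U \<Longrightarrow> f y = (0::real)"
  shows "(deriv ^^ n) f x = 0"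
  using assms(2)
proof (induction n arbitrary: x)
  case (Suc n)
  have "\<forall>\<^sub>F y in nhds x. (deriv ^^ n) f y = 0"
    using eventually_nhds_in_open[OF \<open>open U\<close> Suc.prems] by (rule eventually_mono) (rule Suc.IH)
  then have "deriv ((deriv ^^ n) f) x = deriv (\<lambda>_. 0) x"
    by (intro deriv_cong_ev) auto
  then show ?case by simp
qed (use assms in auto)

text \<open>Multiplication by u is a bounded operator for the C^n norm on [A, B]. The constant is
  fixed before f, so an approximation can later be chosen accurate enough to compensate for it. The
  induction on n generalises u: in (u f)' = u' f + u f' the hypothesis is used for u and for
  u'.\<close>

lemma smooth_mult_bound:
  assumes "smooth u"
  obtains C where "C > 0"
    "\<And>f \<epsilon> k x. smooth f \<Longrightarrow> (\<And>k x. k \<le> n \<Longrightarrow> x \<in> {A..B} \<Longrightarrow> \<bar>(deriv ^^ k) f x\<bar> \<le> \<epsilon>) \<Longrightarrow>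
        k \<le> n \<Longrightarrow> x \<in> {A..B} \<Longrightarrow> \<bar>(deriv ^^ k) (\<lambda>x. u x * f x) x\<bar> \<le> C * \<epsilon>"
  using assms
proof (induction n arbitrary: u thesis)
  case 0
  have "compact (u ` {A..B})"
    using 0 by (intro compact_continuous_image smooth_continuous_on) auto
  then obtain C where C: "C > 0" "\<And>x. x \<in> {A..B} \<Longrightarrow> \<bar>u x\<bar> \<le> C"
    using compact_imp_bounded[of "u ` {A..B}"] unfolding bounded_pos by auto
  show ?case
  proof (rule 0(1)[OF C(1)])
    fix f \<epsilon> k x
    assume f: "\<And>k x. k \<le> 0 \<Longrightarrow> x \<in> {A..B} \<Longrightarrow> \<bar>(deriv ^^ k) f x\<bar> \<le> \<epsilon>"
      and "k \<le> (0::nat)" "x \<in> {A..B}"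
    then show "\<bar>(deriv ^^ k) (\<lambda>x. u x * f x) x\<bar> \<le> C * \<epsilon>"
      using f[of 0 x] C(2)[of x] \<open>C > 0\<close> by (auto simp: abs_mult intro!: mult_mono)
  qed
next
  case (Suc n)
  obtain C1 where C1: "C1 > 0" "\<And>f \<epsilon> k x. smooth f \<Longrightarrow>
      (\<And>k x. k \<le> n \<Longrightarrow> x \<in> {A..B} \<Longrightarrow> \<bar>(deriv ^^ k) f x\<bar> \<le> \<epsilon>) \<Longrightarrow>
      k \<le> n \<Longrightarrow> x \<in> {A..B} \<Longrightarrow> \<bar>(deriv ^^ k) (\<lambda>x. u x * f x) x\<bar> \<le> C1 * \<epsilon>"
    using Suc.IH[OF _ Suc.prems(2)] by blast
  obtain C2 where C2: "C2 > 0" "\<And>f \<epsilon> k x. smooth f \<Longrightarrow>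
      (\<And>k x. k \<le> n \<Longrightarrow> x \<in> {A..B} \<Longrightarrow> \<bar>(deriv ^^ k) f x\<bar> \<le> \<epsilon>) \<Longrightarrow>
      k \<le> n \<Longrightarrow> x \<in> {A..B} \<Longrightarrow> \<bar>(deriv ^^ k) (\<lambda>x. deriv u x * f x) x\<bar> \<le> C2 * \<epsilon>"
    using Suc.IH[OF _ smooth_deriv[OF Suc.prems(2)]] by blast
  show ?case
  proof (rule Suc.prems(1))
    show "C1 + C2 > 0" using C1(1) C2(1) by simp
    fix f \<epsilon> k x
    assume "smooth f" and f: "\<And>k x. k \<le> Suc n \<Longrightarrow> x \<in> {A..B} \<Longrightarrow> \<bar>(deriv ^^ k) f x\<bar> \<le> \<epsilon>"
      and k: "k \<le> Suc n" and x: "x \<in> {A..B}"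
    have "\<epsilon> \<ge> 0" using f[OF _ x, of 0] by simp
    have f': "\<bar>(deriv ^^ k) (deriv f) x\<bar> \<le> \<epsilon>" if "k \<le> n" "x \<in> {A..B}" for k x
      using f[of "Suc k" x] that by (simp only: funpow_Suc_deriv)
    show "\<bar>(deriv ^^ k) (\<lambda>x. u x * f x) x\<bar> \<le> (C1 + C2) * \<epsilon>"
    proof (cases k)
      case 0
      then show ?thesis
        using C1(2)[OF \<open>smooth f\<close>, of \<epsilon> 0 x] f x \<open>\<epsilon> \<ge> 0\<close> C2(1)
        by (auto simp: algebra_simps intro: add_increasing2)
    next
      case (Suc j)
      have "(deriv ^^ k) (\<lambda>x. u x * f x) x
          = (deriv ^^ j) (\<lambda>x. deriv u x * f x) x + (deriv ^^ j) (\<lambda>x. u x * deriv f x) x"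
        unfolding Suc funpow_Suc_deriv using \<open>smooth f\<close> Suc.prems(2)
        by (simp add: deriv_smooth_mult higher_deriv_smooth_add smooth_mult smooth_deriv)
      moreover have "\<bar>(deriv ^^ j) (\<lambda>x. deriv u x * f x) x\<bar> \<le> C2 * \<epsilon>"
        using f k x Suc by (intro C2(2)[OF \<open>smooth f\<close>]) auto
      moreover have "\<bar>(deriv ^^ j) (\<lambda>x. u x * deriv f x) x\<bar> \<le> C1 * \<epsilon>"
        using f' k x Suc by (intro C1(2)[OF smooth_deriv[OF \<open>smooth f\<close>]]) auto
      ultimately show ?thesis by (simp add: algebra_simps)
    qed
  qed
qed

subsection \<open>Approximation by polynomials over a dense subfield\<close>

lemma polys_over_pCons:
  "a \<in> F \<Longrightarrow> p \<in> polys_over F \<Longrightarrow> pCons a p \<in> polys_over F"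
  by (auto simp: polys_over_def coeff_pCons split: nat.split)

lemma polys_over_monom:
  "subfield_of_reals F \<Longrightarrow> c \<in> F \<Longrightarrow> monom c n \<in> polys_over F"
  by (auto simp: polys_over_def subfield_of_reals_def)

lemma polys_over_add:
  "subfield_of_reals F \<Longrightarrow> p \<in> polys_over F \<Longrightarrow> q \<in> polys_over F \<Longrightarrow> p + q \<in> polys_over F"
  by (auto simp: polys_over_def subfield_of_reals_def)

lemma dense_approx:
  assumes "closure F = (UNIV :: real set)" "\<epsilon> > 0"
  obtains a' where "a' \<in> F" "\<bar>a - a'\<bar> < \<epsilon>"
  using assms closure_approachable[of a F]
  by (auto simp: dist_real_def abs_minus_commute)

text \<open>On a bounded interval a small change of the coefficients changes the values little; the
  coefficients are moved into F one at a time along the Horner form.\<close>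

lemma poly_approx_over:
  assumes F: "subfield_of_reals F" "closure F = UNIV" and "\<epsilon> > 0"
  shows "\<exists>q\<in>polys_over F. \<forall>x\<in>{A..B}. \<bar>poly p x - poly q x\<bar> \<le> \<epsilon>"
  using \<open>\<epsilon> > 0\<close>
proof (induction p arbitrary: \<epsilon>)
  case 0
  then show ?case
    using F by (intro bexI[of _ 0]) (auto simp: polys_over_def subfield_of_reals_def)
next
  case (pCons a p)
  \<comment> \<open>R is a positive bound for |x| on [A, B]. The constant coefficient and the tail
    each receive half of the error.\<close>
  define R where "R = \<bar>A\<bar> + \<bar>B\<bar> + 1"
  have "R > 0" by (simp add: R_def)
  obtain a' where a': "a' \<in> F" "\<bar>a - a'\<bar> < \<epsilon> / 2"
    using dense_approx[OF F(2), of "\<epsilon> / 2" a] pCons.prems by auto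
  obtain q where q: "q \<in> polys_over F" "\<And>x. x \<in> {A..B} \<Longrightarrow> \<bar>poly p x - poly q x\<bar> \<le> \<epsilon> / 2 / R"
    using pCons.IH[of "\<epsilon> / 2 / R"] pCons.prems \<open>R > 0\<close> by auto
  have "\<bar>poly (pCons a p) x - poly (pCons a' q) x\<bar> \<le> \<epsilon>" if "x \<in> {A..B}" for x
  proof -
    have "\<bar>x * (poly p x - poly q x)\<bar> \<le> R * (\<epsilon> / 2 / R)"
      unfolding abs_mult using q(2)[OF that] that \<open>R > 0\<close>
      by (intro mult_mono) (auto simp: R_def)
    also have "\<dots> = \<epsilon> / 2" using \<open>R > 0\<close> by simp
    finally show ?thesis
      using a'(2) unfolding poly_pCons right_diff_distrib by linarith
  qed
  then show ?case
    using polys_over_pCons[OF a'(1) q(1)] by blast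
qed

text \<open>A term c x^N with N above both d and the degree of q raises the degree, and a small
  nonzero c in F keeps the change below \<epsilon>.\<close>

lemma poly_small_degree_perturbation:
  assumes F: "subfield_of_reals F" "closure F = UNIV" and "\<epsilon> > 0" and q: "q \<in> polys_over F"
  obtains p where "p \<in> polys_over F" "degree p > d"
    "\<And>x. x \<in> {A..B} \<Longrightarrow> \<bar>poly p x - poly q x\<bar> \<le> \<epsilon>"
proof -
  define N where "N = Suc (max d (degree q))"
  define R where "R = (\<bar>A\<bar> + \<bar>B\<bar> + 1) ^ N"
  have "R > 0" by (simp add: R_def add_nonneg_pos)
  \<comment> \<open>Approximating the midpoint of (0, \<epsilon> / R) to within half its length
    keeps c strictly inside, hence nonzero.\<close>
  obtain c where c: "c \<in> F" "\<bar>\<epsilon> / (2 * R) - c\<bar> < \<epsilon> / (2 * R)"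
    using dense_approx[OF F(2), of "\<epsilon> / (2 * R)" "\<epsilon> / (2 * R)"] \<open>\<epsilon> > 0\<close> \<open>R > 0\<close> by auto
  then have "c > 0" "c < \<epsilon> / R" by (auto simp: abs_if split: if_splits)
  show ?thesis
  proof
    show "monom c N + q \<in> polys_over F"
      using F q c by (intro polys_over_add polys_over_monom)
    have "degree (monom c N + q) = N"
      using \<open>c > 0\<close> by (subst degree_add_eq_left) (auto simp: N_def degree_monom_eq)
    then show "degree (monom c N + q) > d" by (simp add: N_def)
    fix x assume "x \<in> {A..B}"
    then have "\<bar>x\<bar> ^ N \<le> R" unfolding R_def by (intro power_mono) auto
    then have "c * \<bar>x\<bar> ^ N \<le> c * R" using \<open>c > 0\<close> by simp
    also have "\<dots> \<le> \<epsilon>" using \<open>c < \<epsilon> / R\<close> \<open>R > 0\<close> by (simp add: field_simps)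
    finally show "\<bar>poly (monom c N + q) x - poly q x\<bar> \<le> \<epsilon>"
      using \<open>c > 0\<close> by (simp add: poly_monom abs_mult power_abs)
  qed
qed

text \<open>The i-th coefficient is divided by a positive integer, which stays in F because a
  subfield of the reals contains the rationals.\<close>

lemma poly_antiderivative_over:
  assumes F: "subfield_of_reals F" and "q \<in> polys_over F"
  obtains p where "p \<in> polys_over F" "pderiv p = q"
proof
  define p where "p = Poly (map (\<lambda>i. if i = 0 then 0 else coeff q (i - 1) * inverse (real i)) [0..<Suc (Suc (degree q))])"
  have p: "coeff p i = (if i = 0 then 0 else coeff q (i - 1) * inverse (real i))" for i
    by (auto simp: p_def coeff_Poly_eq nth_default_def coeff_eq_0 simp del: upt_Suc)
  have nat: "real i \<in> F" for i
    using F by (induction i) (auto simp: subfield_of_reals_def)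
  have "inverse (real (Suc i)) \<in> F" for i
    using F nat[of "Suc i"] unfolding subfield_of_reals_def by (metis of_nat_neq_0)
  moreover have "0 \<in> F" and "\<And>x y. x \<in> F \<Longrightarrow> y \<in> F \<Longrightarrow> x * y \<in> F"
    using F by (auto simp: subfield_of_reals_def)
  ultimately have "coeff p i \<in> F" for i
    using assms(2) unfolding p polys_over_def by (cases i) auto
  then show "p \<in> polys_over F"
    by (simp add: polys_over_def)
  show "pderiv p = q"
    by (rule poly_eqI) (simp add: coeff_pderiv p del: of_nat_Suc)
qed

text \<open>Induction on n: approximate g' in C^n by q and integrate, taking the constant of
  integration from F. Integration does not lower the degree, so the bound d carries over. For n = 0
  the error is split in three: Stone-Weierstrass, moving the coefficients into F, and raising the
  degree.\<close>

lemma smooth_approx_poly_over: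
  assumes F: "subfield_of_reals F" "closure F = UNIV"
    and "A < B" "smooth g" "\<epsilon> > 0"
  shows "\<exists>p\<in>polys_over F. degree p > d \<and>
    (\<forall>k\<le>n. \<forall>x\<in>{A..B}. \<bar>(deriv ^^ k) (\<lambda>x. poly p x - g x) x\<bar> \<le> \<epsilon>)"
  using \<open>smooth g\<close> \<open>\<epsilon> > 0\<close>
proof (induction n arbitrary: g \<epsilon>)
  case 0
  obtain r where r: "real_polynomial_function r" "\<And>x. x \<in> {A..B} \<Longrightarrow> \<bar>g x - r x\<bar> < \<epsilon> / 3"
    using Stone_Weierstrass_real_polynomial_function[OF compact_Icc smooth_continuous_on[OF 0(1)], of "\<epsilon> / 3" A B]
      0(2) by auto
  obtain p where p: "r = poly p"
  proof -
    obtain a n where "r = (\<lambda>x. \<Sum>i\<le>n. a i * x ^ i)"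
      using r(1) unfolding real_polynomial_function_iff_sum by blast
    then have "r = poly (\<Sum>i\<le>n. monom (a i) i)"
      by (auto simp: poly_sum poly_monom fun_eq_iff)
    then show ?thesis using that by blast
  qed
  obtain q where q: "q \<in> polys_over F" "\<And>x. x \<in> {A..B} \<Longrightarrow> \<bar>poly p x - poly q x\<bar> \<le> \<epsilon> / 3"
    using poly_approx_over[OF F, of "\<epsilon> / 3" A B p] 0(2) by auto
  obtain s where s: "s \<in> polys_over F" "degree s > d"
    "\<And>x. x \<in> {A..B} \<Longrightarrow> \<bar>poly s x - poly q x\<bar> \<le> \<epsilon> / 3"
    using poly_small_degree_perturbation[OF F _ q(1), of "\<epsilon> / 3" d A B] 0(2) by auto
  have "\<bar>poly s x - g x\<bar> \<le> \<epsilon>" if "x \<in> {A..B}" for x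
    using r(2)[OF that] q(2)[OF that] s(3)[OF that] unfolding p by linarith
  with s show ?case by auto
next
  case (Suc n)
  \<comment> \<open>The bound by \<epsilon> serves the derivatives of order at least 1. The other
    one makes the error grow by at most \<epsilon> / 2 along [A, B]; the remaining \<epsilon> / 2 is
    for the error at A.\<close>
  define \<delta> where "\<delta> = min \<epsilon> (\<epsilon> / 2 / (B - A))"
  have "\<delta> > 0" "\<delta> \<le> \<epsilon>" "\<delta> * (B - A) \<le> \<epsilon> / 2"
    using Suc.prems \<open>A < B\<close> by (auto simp: \<delta>_def min_def field_simps)
  obtain q where q: "q \<in> polys_over F" "degree q > d"
    "\<And>k x. k \<le> n \<Longrightarrow> x \<in> {A..B} \<Longrightarrow> \<bar>(deriv ^^ k) (\<lambda>x. poly q x - deriv g x) x\<bar> \<le> \<delta>"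
    using Suc.IH[OF smooth_deriv[OF Suc.prems(1)] \<open>\<delta> > 0\<close>] by blast
  obtain p0 where p0: "p0 \<in> polys_over F" "pderiv p0 = q"
    using poly_antiderivative_over[OF F(1) q(1)] .
  obtain c where c: "c \<in> F" "\<bar>g A - poly p0 A - c\<bar> < \<epsilon> / 2"
    using dense_approx[OF F(2), of "\<epsilon> / 2" "g A - poly p0 A"] Suc.prems by auto
  define p where "p = monom c 0 + p0"
  have p: "p \<in> polys_over F"
    unfolding p_def by (intro polys_over_add polys_over_monom F c p0)
  have dp: "pderiv p = q"
    by (simp add: p_def p0 pderiv_add pderiv_monom)
  have deg: "degree p > d"
    using q(2) dp by (metis degree_pderiv diff_le_self le_less_trans less_le_trans not_le)
  have D: "((\<lambda>x. poly p x - g x) has_real_derivative (poly q x - deriv g x)) (at x)" for x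
    using DERIV_diff[OF poly_DERIV smooth_has_deriv[OF Suc.prems(1)]] dp by metis
  then have deriv: "deriv (\<lambda>x. poly p x - g x) = (\<lambda>x. poly q x - deriv g x)"
    by (auto intro: DERIV_imp_deriv)
  have "\<bar>(deriv ^^ k) (\<lambda>x. poly p x - g x) x\<bar> \<le> \<epsilon>" if k: "k \<le> Suc n" and x: "x \<in> {A..B}" for k x
  proof (cases k)
    case 0
    have "norm ((poly p x - g x) - (poly p A - g A)) \<le> \<delta> * norm (x - A)"
    proof (rule field_differentiable_bound[of "{A..B}"])
      show "((\<lambda>x. poly p x - g x) has_field_derivative (poly q y - deriv g y)) (at y within {A..B})" for y
        using D by (rule has_field_derivative_at_within)
      show "norm (poly q y - deriv g y) \<le> \<delta>" if "y \<in> {A..B}" for y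
        using q(3)[of 0 y] that by simp
    qed (use x \<open>A < B\<close> in auto)
    also have "\<dots> \<le> \<delta> * (B - A)"
      using x \<open>\<delta> > 0\<close> by (intro mult_left_mono) auto
    finally have "\<bar>(poly p x - g x) - (poly p A - g A)\<bar> \<le> \<epsilon> / 2"
      using \<open>\<delta> * (B - A) \<le> \<epsilon> / 2\<close> by simp
    moreover have "\<bar>poly p A - g A\<bar> < \<epsilon> / 2"
      using c by (simp add: p_def poly_monom algebra_simps abs_minus_commute)
    ultimately show ?thesis unfolding 0 funpow_0 by linarith
  next
    case (Suc j)
    then show ?thesis
      using q(3)[of j x] k x \<open>\<delta> \<le> \<epsilon>\<close> unfolding Suc funpow_Suc_deriv deriv by simp
  qed
  with p deg show ?case by blast
qed

section \<open>Local corrections and their infinite sum\<close>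

text \<open>One stage of the construction: h = u (p - g), where u is a cutoff equal to 1 on [a, b]
  and p approximates g in C^n on a neighbourhood [A, B] that avoids C.\<close>

lemma smooth_correction:
  assumes F: "subfield_of_reals F" "closure F = UNIV"
    and "smooth g" "\<epsilon> > 0" "a \<le> b" "closed C" "C \<inter> {a..b} = {}"
  obtains h p where "smooth h" "p \<in> polys_over F" "degree p > d"
    "\<And>x. x \<in> C \<Longrightarrow> h x = 0" "\<And>x. x \<in> {a..b} \<Longrightarrow> g x + h x = poly p x"
    "\<And>k x. k \<le> n \<Longrightarrow> \<bar>(deriv ^^ k) h x\<bar> \<le> \<epsilon>"
proof -
  have "a \<in> - C" "b \<in> - C" "open (- C)" using assms by auto
  then obtain e1 e2 where e: "e1 > 0" "e2 > 0" "ball a e1 \<subseteq> - C" "ball b e2 \<subseteq> - C"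
    by (meson openE)
  \<comment> \<open>Half the radii, so that the closed interval [A, B] still misses C.\<close>
  define A B where "A = a - e1 / 2" and "B = b + e2 / 2"
  have AB: "A < a" "b < B" using e by (auto simp: A_def B_def)
  have sub: "x \<notin> C" if "x \<in> {A..B}" for x
  proof (cases "x < a")
    case True
    then have "x \<in> ball a e1" using that e by (auto simp: A_def dist_real_def)
    then show ?thesis using e by auto
  next
    case False
    show ?thesis
    proof (cases "x \<le> b")
      case True
      then show ?thesis using False assms by auto
    next
      case False
      then have "x \<in> ball b e2" using that e by (auto simp: B_def dist_real_def)
      then show ?thesis using e by auto
    qed
  qed
  obtain u where u: "smooth u" "\<And>x. x \<in> {a..b} \<Longrightarrow> u x = 1" "\<And>x. x \<notin> {A<..<B} \<Longrightarrow> u x = 0"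
    using smooth_cutoff[OF AB(1) \<open>a \<le> b\<close> AB(2)] by blast
  obtain M where M: "M > 0" "\<And>f \<epsilon> k x. smooth f \<Longrightarrow>
      (\<And>k x. k \<le> n \<Longrightarrow> x \<in> {A..B} \<Longrightarrow> \<bar>(deriv ^^ k) f x\<bar> \<le> \<epsilon>) \<Longrightarrow>
      k \<le> n \<Longrightarrow> x \<in> {A..B} \<Longrightarrow> \<bar>(deriv ^^ k) (\<lambda>x. u x * f x) x\<bar> \<le> M * \<epsilon>"
    using smooth_mult_bound[OF u(1), where n = n and A = A and B = B] by blast
  have "A < B" "\<epsilon> / M > 0" using AB \<open>a \<le> b\<close> \<open>\<epsilon> > 0\<close> M by auto
  then obtain p where p: "p \<in> polys_over F" "degree p > d"
    "\<And>k x. k \<le> n \<Longrightarrow> x \<in> {A..B} \<Longrightarrow> \<bar>(deriv ^^ k) (\<lambda>x. poly p x - g x) x\<bar> \<le> \<epsilon> / M"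
    using smooth_approx_poly_over[OF F _ \<open>smooth g\<close>, of A B "\<epsilon> / M" d n] by blast
  have sm: "smooth (\<lambda>x. poly p x - g x)" by (intro smooth_diff smooth_poly \<open>smooth g\<close>)
  let ?h = "\<lambda>x. u x * (poly p x - g x)"
  show ?thesis
  proof
    show "smooth ?h" by (intro smooth_mult u sm)
    show "?h x = 0" if "x \<in> C" for x
    proof -
      have "x \<notin> {A<..<B}" using sub[of x] that by auto
      from u(3)[OF this] show ?thesis by simp
    qed
    show "g x + ?h x = poly p x" if "x \<in> {a..b}" for x using u(2)[OF that] by simp
    show "\<bar>(deriv ^^ k) ?h x\<bar> \<le> \<epsilon>" if "k \<le> n" for k x
    proof (cases "x \<in> {A..B}")
      case True
      then show ?thesis
        using M(2)[OF sm p(3) that True] M(1) by simp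
    next
      case False
      \<comment> \<open>The complement of [A, B] is open and u vanishes on it, so all derivatives of
        the correction vanish there too.\<close>
      have "(deriv ^^ k) ?h x = 0"
        by (rule higher_deriv_zero_open[of "- {A..B}"]) (use False u(3) in auto)
      then show ?thesis using \<open>\<epsilon> > 0\<close> by simp
    qed
  qed (use p in auto)
qed

text \<open>For each k the geometric bound covers all but the first k terms, which suffices for
  uniform convergence of the k-th derivatives and differentiation term by term. The coinduction runs
  over all termwise differentiated series.\<close>

lemma smooth_suminf:
  assumes "\<And>n. smooth (h n)"
    and bound: "\<And>n k x. k \<le> n \<Longrightarrow> \<bar>(deriv ^^ k) (h n) x\<bar> \<le> (1/2) ^ n"
  shows "smooth (\<lambda>x. \<Sum>n. h n x)"
proof (rule smooth_coinduct[where S = "range (\<lambda>k x. \<Sum>n. (deriv ^^ k) (h n) x)"])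
  show "(\<lambda>x. \<Sum>n. h n x) \<in> range (\<lambda>k x. \<Sum>n. (deriv ^^ k) (h n) x)"
    by (rule range_eqI[of _ _ 0]) simp
  have geom: "summable (\<lambda>n. (1/2::real) ^ n)" by (simp add: summable_geometric)
  have ev: "\<forall>\<^sub>F n in sequentially. \<forall>x\<in>A. norm ((deriv ^^ k) (h n) x) \<le> (1/2) ^ n" for k A
    using eventually_ge_at_top[of k] by (rule eventually_mono) (use bound in auto)
  fix f assume "f \<in> range (\<lambda>k x. \<Sum>n. (deriv ^^ k) (h n) x)"
  then obtain k where k: "f = (\<lambda>x. \<Sum>n. (deriv ^^ k) (h n) x)" by blast
  have "((\<lambda>x. \<Sum>n. (deriv ^^ k) (h n) x) has_field_derivative (\<Sum>n. (deriv ^^ Suc k) (h n) x)) (at x)" for x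
  proof (rule has_field_derivative_series'(2)[of UNIV _ _ 0])
    show "((deriv ^^ k) (h n) has_field_derivative (deriv ^^ Suc k) (h n) y) (at y within UNIV)" for n y
      using smooth_has_deriv[OF smooth_higher_deriv[OF assms(1)]] by simp
    show "uniformly_convergent_on UNIV (\<lambda>n x. \<Sum>i<n. (deriv ^^ Suc k) (h i) x)"
      by (rule Weierstrass_m_test'_ev[OF ev geom])
    show "summable (\<lambda>n. (deriv ^^ k) (h n) 0)"
      by (rule summable_comparison_test_ev[OF _ geom]) (use ev[of "{0}" k] in simp)
  qed auto
  then show "\<exists>f'\<in>range (\<lambda>k x. \<Sum>n. (deriv ^^ k) (h n) x). \<forall>x. (f has_real_derivative f' x) (at x)"
    unfolding k by (intro bexI[of _ "\<lambda>x. \<Sum>n. (deriv ^^ Suc k) (h n) x"]) blast+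
qed

text \<open>The inductive construction, for arbitrary disjoint compact intervals given by their
  endpoints. Injectivity of P, obtained from strictly increasing degrees, is what later rules out
  analyticity.\<close>

lemma smooth_polynomial_on_intervals:
  fixes C F :: "real set" and G :: "(real \<times> real) set"
  defines "K \<equiv> \<lambda>p. {fst p..snd p}"
  assumes F: "subfield_of_reals F" "closure F = UNIV"
    and "closed C" "countable G"
    and G: "\<And>p. p \<in> G \<Longrightarrow> fst p \<le> snd p" "\<And>p. p \<in> G \<Longrightarrow> C \<inter> K p = {}"
    and disj: "\<And>p q. p \<in> G \<Longrightarrow> q \<in> G \<Longrightarrow> p \<noteq> q \<Longrightarrow> K p \<inter> K q = {}"
  obtains g P where "smooth g" "\<And>x. x \<in> C \<Longrightarrow> g x = 0" "inj_on P G" "P ` G \<subseteq> polys_over F"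
    "\<And>p x. p \<in> G \<Longrightarrow> x \<in> K p \<Longrightarrow> g x = poly (P p) x"
proof -
  define idx where "idx = to_nat_on G"
  have inj: "inj_on idx G" unfolding idx_def using \<open>countable G\<close> by (rule inj_on_to_nat_on)
  \<comment> \<open>The region frozen from stage n on. It is closed, being C with finitely many
    compact intervals added.\<close>
  define D where "D n = C \<union> (\<Union>p\<in>{p\<in>G. idx p < n}. K p)" for n
  have fin: "finite {p\<in>G. idx p < n}" for n
    by (rule finite_imageD[of idx])
       (auto intro: finite_subset[of _ "{..<n}"] inj_on_subset[OF inj])
  have closed_D: "closed (D n)" for n
    unfolding D_def using fin[of n] \<open>closed C\<close> by (auto simp: K_def)
  have D_mono: "D m \<subseteq> D n" if "m \<le> n" for m n
    using that by (force simp: D_def)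
  \<comment> \<open>Admissible transitions at stage n. A state is the current function together with
    the last polynomial used, which records the degree to be exceeded.\<close>
  define R where "R n s t \<longleftrightarrow> snd t \<in> polys_over F \<and> degree (snd s) < degree (snd t) \<and>
      (\<forall>x\<in>D n. fst t x = fst s x) \<and> (\<forall>p\<in>G. idx p = n \<longrightarrow> (\<forall>x\<in>K p. fst t x = poly (snd t) x)) \<and>
      (\<forall>k\<le>n. \<forall>x. \<bar>(deriv ^^ k) (\<lambda>x. fst t x - fst s x) x\<bar> \<le> (1/2) ^ n)"
    for n and s t :: "(real \<Rightarrow> real) \<times> real poly"
  have step: "\<exists>t. smooth (fst t) \<and> R n s t" if s: "smooth (fst s)" for n s
  proof (cases "\<exists>p\<in>G. idx p = n")
    case True
    then obtain p where p: "p \<in> G" "idx p = n" by blast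
    have "D n \<inter> {fst p..snd p} = {}"
      using G(2)[OF p(1)] disj[OF p(1)] p(2) by (fastforce simp: D_def K_def)
    from smooth_correction[OF F s _ G(1)[OF p(1)] closed_D this, of "(1/2) ^ n" "degree (snd s)" n]
    obtain h q where h: "smooth h" "q \<in> polys_over F" "degree q > degree (snd s)"
      "\<And>x. x \<in> D n \<Longrightarrow> h x = 0" "\<And>x. x \<in> {fst p..snd p} \<Longrightarrow> fst s x + h x = poly q x"
      "\<And>k x. k \<le> n \<Longrightarrow> \<bar>(deriv ^^ k) h x\<bar> \<le> (1/2) ^ n"
      by auto
    have "\<forall>x\<in>K p'. fst s x + h x = poly q x" if "p' \<in> G" "idx p' = n" for p'
    proof -
      have "p' = p" using that p inj by (metis inj_onD)
      then show ?thesis using h by (simp add: K_def)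
    qed
    then have "R n s (\<lambda>x. fst s x + h x, q)"
      unfolding R_def using h by simp
    moreover have "smooth (\<lambda>x. fst s x + h x)" by (intro smooth_add s h)
    ultimately show ?thesis by (metis fst_conv)
  next
    case False
    \<comment> \<open>No interval has index n, as happens when G is finite. The function stays, and
      a monomial of higher degree keeps the degrees strictly increasing.\<close>
    let ?q = "monom 1 (Suc (degree (snd s))) :: real poly"
    have "(deriv ^^ k) (\<lambda>_. 0 :: real) x = 0" for k x
      by (rule higher_deriv_zero_open[of UNIV]) auto
    then have "R n s (fst s, ?q)"
      using False F polys_over_monom[OF F(1), of 1] by (auto simp: R_def degree_monom_eq subfield_of_reals_def)
    with s show ?thesis by (metis fst_conv)
  qed
  \<comment> \<open>Dependent choice from the zero function. The initial polynomial is arbitrary: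
    its degree is only a lower bound to be exceeded.\<close>
  have "\<exists>f. \<forall>n. (smooth (fst (f n)) \<and> (n = 0 \<longrightarrow> fst (f n) = (\<lambda>_. 0))) \<and> R n (f n) (f (Suc n))"
  proof (rule dependent_nat_choice)
    show "\<exists>x. smooth (fst x) \<and> ((0::nat) = 0 \<longrightarrow> fst x = (\<lambda>_. 0))"
      by (rule exI[of _ "(\<lambda>_. 0, undefined)"]) (simp add: smooth_const)
  qed (use step in auto)
  then obtain f where sm: "\<And>n. smooth (fst (f n))" and f0: "fst (f 0) = (\<lambda>_. 0)"
    and R: "\<And>n. R n (f n) (f (Suc n))"
    by metis
  define h where "h n x = fst (f (Suc n)) x - fst (f n) x" for n x
  define g where "g x = (\<Sum>n. h n x)" for x
  define P where "P p = snd (f (Suc (idx p)))" for p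
  \<comment> \<open>On D m every correction from stage m on vanishes, so the series is a finite sum
    that telescopes.\<close>
  have stable: "g x = fst (f m) x" if "x \<in> D m" for x m
  proof -
    have "h n x = 0" if "n \<notin> {..<m}" for n
      using R[of n] D_mono[of m n] that \<open>x \<in> D m\<close> by (auto simp: R_def h_def)
    then have "g x = (\<Sum>n<m. h n x)"
      unfolding g_def by (intro suminf_finite) auto
    then show ?thesis
      unfolding h_def using sum_lessThan_telescope[of "\<lambda>n. fst (f n) x" m] f0 by simp
  qed
  show ?thesis
  proof
    show "smooth g"
      unfolding g_def
    proof (rule smooth_suminf)
      show "smooth (h n)" for n
        unfolding h_def by (intro smooth_diff sm)
      show "\<bar>(deriv ^^ k) (h n) x\<bar> \<le> (1/2) ^ n" if "k \<le> n" for n k x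
        using R[of n] that unfolding R_def h_def by blast
    qed
    show "g x = 0" if "x \<in> C" for x
      using stable[of x 0] that by (simp add: D_def f0)
    have "strict_mono (\<lambda>n. degree (snd (f n)))"
      using R by (auto simp: strict_mono_Suc_iff R_def)
    then have "idx p = idx q" if "P p = P q" for p q
      using that strict_mono_eq[of "\<lambda>n. degree (snd (f n))" "Suc (idx p)" "Suc (idx q)"]
      by (simp add: P_def)
    then show "inj_on P G"
      using inj by (meson inj_onD inj_onI)
    show "P ` G \<subseteq> polys_over F"
      using R by (auto simp: P_def R_def)
    show "g x = poly (P p) x" if "p \<in> G" "x \<in> K p" for p x
    proof -
      have "g x = fst (f (Suc (idx p))) x"
        using that by (intro stable) (unfold D_def, blast)
      also have "\<dots> = poly (P p) x"
        using R[of "idx p"] that by (auto simp: P_def R_def)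
      finally show ?thesis .
    qed
  qed
qed

subsection \<open>Real-analyticity and polynomial pieces\<close>

lemma poly_eq_on_open_interval:
  fixes p q :: "real poly"
  assumes "a < b" "\<And>x. x \<in> {a<..<b} \<Longrightarrow> poly p x = poly q x"
  shows "p = q"
proof (rule ccontr)
  assume "p \<noteq> q"
  then have "finite {x. poly (p - q) x = 0}" by (intro poly_roots_finite) auto
  moreover have "{a<..<b} \<subseteq> {x. poly (p - q) x = 0}" using assms by auto
  ultimately show False using infinite_Ioo[OF \<open>a < b\<close>] finite_subset by blast
qed

lemma poly_map_of_real: "poly (map_poly of_real p) (of_real x) = (of_real (poly p x) :: complex)"
  by (induction p) (auto simp: map_poly_pCons)

text \<open>The expansion at x is the recentred polynomial p(x + h), a finite power series.\<close>

lemma real_analytic_at_poly: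
  assumes "\<forall>\<^sub>F y in nhds x. g y = poly p y"
  shows "real_analytic_at g x"
  unfolding real_analytic_at_def
proof
  have "((\<lambda>h. x + h) \<longlongrightarrow> x + 0) (nhds 0)"
    by (intro tendsto_intros filterlim_ident)
  then have "\<forall>\<^sub>F h in nhds 0. g (x + h) = poly p (x + h)"
    using eventually_compose_filterlim[OF assms, of "\<lambda>h. x + h" "nhds 0"] by simp
  then show "(\<lambda>h. g (x + h)) has_fps_expansion fps_of_poly (pcompose p [:x, 1:])"
    unfolding has_fps_expansion_def by (auto simp: poly_pcompose elim: eventually_mono)
qed

text \<open>The real power series also converges on a complex disc, where the identity theorem for
  holomorphic functions compares it with p. The radius is chosen before p, so that different
  polynomial pieces can be compared on one ball.\<close>

lemma real_analytic_at_poly_extends: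
  assumes "real_analytic_at g x"
  obtains r where "r > 0"
    "\<And>a b p. a < b \<Longrightarrow> {a<..<b} \<subseteq> ball x r \<Longrightarrow> \<forall>y\<in>{a<..<b}. g y = poly p y \<Longrightarrow>
       \<forall>y\<in>ball x r. g y = poly p y"
proof -
  obtain A where A: "fps_conv_radius A > 0" "\<forall>\<^sub>F z in nhds 0. eval_fps A z = g (x + z)"
    using assms unfolding real_analytic_at_def has_fps_expansion_def by auto
  obtain r1 where r1: "r1 > 0" "\<And>z. \<bar>z\<bar> < r1 \<Longrightarrow> eval_fps A z = g (x + z)"
    using A(2) unfolding eventually_nhds_metric by (auto simp: dist_real_def)
  obtain r2 where r2: "r2 > 0" "ereal r2 < fps_conv_radius A"
    using ereal_dense2[OF A(1)] by auto
  \<comment> \<open>Within r1 the series represents g; within r2 it lies strictly inside the disc of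
    convergence.\<close>
  define r where "r = min r1 r2"
  have r: "r > 0" "r \<le> r1" "ereal r < fps_conv_radius A"
    using r1 r2 le_less_trans[of "ereal r" "ereal r2"] by (auto simp: r_def)
  define B :: "complex fps" where "B = Abs_fps (\<lambda>n. of_real (fps_nth A n))"
  have "(\<lambda>n. norm (fps_nth B n)) = (\<lambda>n. norm (fps_nth A n))"
    by (simp add: B_def)
  then have "conv_radius (fps_nth B) = conv_radius (fps_nth A)"
    by (metis conv_radius_norm)
  then have rad: "fps_conv_radius B = fps_conv_radius A"
    by (simp add: fps_conv_radius_def)
  have in_disc: "ereal (cmod z) < fps_conv_radius B" if "cmod z < r" for z
    using that r le_less_trans[of "ereal (cmod z)" "ereal r"] by (simp add: rad)
  have B: "eval_fps B (of_real z) = of_real (g (x + z))" if "\<bar>z\<bar> < r" for z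
  proof -
    have "summable (\<lambda>n. fps_nth A n * z ^ n)"
      using that r by (intro summable_fps) (auto intro: le_less_trans[of _ "ereal r"])
    then have "eval_fps B (of_real z) = of_real (eval_fps A z)"
      by (simp add: eval_fps_def B_def suminf_of_real)
    then show ?thesis using r1 r that by simp
  qed
  have ext: "g y = poly p y" if "a < b" and sub_ball: "{a<..<b} \<subseteq> ball x r"
    and gp: "\<forall>y\<in>{a<..<b}. g y = poly p y" and y_ball: "y \<in> ball x r" for a b p y
  proof -
    let ?U = "(\<lambda>y. complex_of_real (y - x)) ` {a<..<b}"
    define m where "m = (a + b) / 2"
    have m: "m \<in> {a<..<b}" using \<open>a < b\<close> by (simp add: m_def)
    have sub: "?U \<subseteq> ball 0 r"
      using sub_ball by (auto simp: dist_real_def abs_minus_commute simp flip: of_real_diff)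
    define p' :: "complex poly" where "p' = map_poly of_real (pcompose p [:x, 1:])"
    have p': "poly p' (of_real (y - x)) = of_real (poly p y)" for y
      unfolding p'_def poly_map_of_real by (simp add: poly_pcompose)
    have "poly p' holomorphic_on ball 0 r"
      by (auto simp: holomorphic_on_def field_differentiable_def intro!: exI DERIV_subset[OF poly_DERIV])
    then have holo: "(\<lambda>z. eval_fps B z - poly p' z) holomorphic_on ball 0 r"
      by (intro holomorphic_intros) (auto simp: in_disc)
    \<comment> \<open>The identity theorem needs a limit point of the zero set inside the disc; the
      midpoint of the interval, shifted by x, is one.\<close>
    have lim: "of_real (m - x) islimpt ?U"
    proof -
      have "m islimpt {a<..<b}" using m by (intro interior_limit_point) simp
      then show ?thesis
        by (intro islimpt_isCont_image continuous_intros) (auto simp: eventually_at_filter)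
    qed
    have zero: "eval_fps B z - poly p' z = 0" if z: "z \<in> ?U" for z
    proof -
      obtain y where y: "y \<in> {a<..<b}" "z = of_real (y - x)" using z by blast
      have "\<bar>y - x\<bar> < r" using y sub_ball by (auto simp: dist_real_def)
      from B[OF this] show ?thesis
        using p'[of y] y gp by simp
    qed
    have "of_real (y - x) \<in> ball (0::complex) r"
      using y_ball by (auto simp: dist_real_def abs_minus_commute simp flip: of_real_diff)
    moreover have "of_real (m - x) \<in> ball (0::complex) r"
      using sub m by blast
    ultimately have "eval_fps B (of_real (y - x)) - poly p' (of_real (y - x)) = 0"
      by (intro analytic_continuation[OF holo open_ball connected_ball sub _ lim zero])
    moreover have "\<bar>y - x\<bar> < r" using y_ball by (auto simp: dist_real_def)
    ultimately have "complex_of_real (g y) = of_real (poly p y)"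
      using B[of "y - x"] p'[of y] by simp
    then show ?thesis by simp
  qed
  show ?thesis
    by (rule that[OF \<open>r > 0\<close>]) (use ext in blast)
qed

subsection \<open>Gaps of a perfect nowhere dense set\<close>

text \<open>For closed E these are the bounded components of the complement. Endpoint pairs give
  direct access to the closed intervals on which g is prescribed.\<close>

definition gaps :: "real set \<Rightarrow> (real \<times> real) set" where
  "gaps E = {(a, b). a \<in> E \<and> b \<in> E \<and> a < b \<and> {a<..<b} \<inter> E = {}}"

text \<open>Endpoints lie in E and hence never inside another gap, so overlapping gaps have the same
  endpoints.\<close>

lemma gaps_eq:
  assumes "(a, b) \<in> gaps E" "(c, d) \<in> gaps E" "z \<in> {a<..<b}" "z \<in> {c<..<d}"
  shows "(a, b) = (c, d)"
proof -
  have *: "a \<in> E" "b \<in> E" "c \<in> E" "d \<in> E" and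
    E: "\<And>x. x \<in> E \<Longrightarrow> \<not> (a < x \<and> x < b)" "\<And>x. x \<in> E \<Longrightarrow> \<not> (c < x \<and> x < d)"
    using assms by (auto simp: gaps_def)
  show ?thesis
    using E(1)[OF *(3)] E(1)[OF *(4)] E(2)[OF *(1)] E(2)[OF *(2)] assms(3,4) by auto
qed

lemma countable_gaps: "countable (gaps E)"
proof -
  \<comment> \<open>A rational number inside each gap identifies the gap.\<close>
  have "\<exists>q. q \<in> \<rat> \<and> fst p < q \<and> q < snd p" if "p \<in> gaps E" for p
    using that Rats_dense_in_real[of "fst p" "snd p"] by (auto simp: gaps_def)
  then obtain q where q: "\<And>p. p \<in> gaps E \<Longrightarrow> q p \<in> \<rat> \<and> fst p < q p \<and> q p < snd p"
    by metis
  have "inj_on q (gaps E)"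
  proof (rule inj_onI)
    fix p p' assume "p \<in> gaps E" "p' \<in> gaps E" "q p = q p'"
    then show "p = p'"
      using gaps_eq[of "fst p" "snd p" E "fst p'" "snd p'" "q p"] q[of p] q[of p'] by simp
  qed
  moreover have "countable (q ` gaps E)"
    by (rule countable_subset[OF _ countable_rat]) (use q in auto)
  ultimately show ?thesis by (metis countable_image_inj_on)
qed

text \<open>The endpoints are the last point of E before x and the first one after it; both are
  attained because E is closed.\<close>

lemma gap_exists:
  assumes "closed E" "x \<notin> E" "e1 \<in> E" "e2 \<in> E" "e1 < x" "x < e2"
  obtains a b where "(a, b) \<in> gaps E" "a < x" "x < b" "e1 \<le> a" "b \<le> e2"
proof
  define a b where "a = Sup (E \<inter> {..x})" and "b = Inf (E \<inter> {x..})"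
  have bdd: "bdd_above (E \<inter> {..x})" "bdd_below (E \<inter> {x..})" by auto
  have "a \<in> E \<inter> {..x}" unfolding a_def
    using assms bdd by (intro closed_contains_Sup closed_Int) auto
  moreover have "b \<in> E \<inter> {x..}" unfolding b_def
    using assms bdd by (intro closed_contains_Inf closed_Int) auto
  ultimately have ab: "a \<in> E" "b \<in> E" "a < x" "x < b"
    using \<open>x \<notin> E\<close> by (auto simp: less_le)
  then show "a < x" "x < b" by auto
  have up: "y \<le> a" if "y \<in> E" "y \<le> x" for y
    unfolding a_def using that bdd by (intro cSup_upper) auto
  have lo: "b \<le> y" if "y \<in> E" "x \<le> y" for y
    unfolding b_def using that bdd by (intro cInf_lower) auto
  show "e1 \<le> a" "b \<le> e2" using up lo assms by auto
  have "{a<..<b} \<inter> E = {}" using up lo by fastforce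
  with ab show "(a, b) \<in> gaps E" by (auto simp: gaps_def)
qed

lemma perfect_not_isolated:
  fixes E :: "real set"
  assumes "perfect E" "a < x" "x < b" "x \<in> E"
  obtains y where "y \<in> E" "y \<noteq> x" "a < y" "y < b"
proof -
  have "x islimpt E"
    using assms unfolding perfect_def isolated_in_islimpt_iff by blast
  moreover have "x \<in> {a<..<b}" using assms by simp
  ultimately obtain y where "y \<in> E" "y \<in> {a<..<b}" "y \<noteq> x"
    using open_greaterThanLessThan unfolding islimpt_def by meson
  then show ?thesis using that by auto
qed

text \<open>Distinct gaps do not overlap, so their closures could meet only in a common endpoint,
  which would then be an isolated point of E.\<close>

lemma gaps_closures_disjoint:
  assumes "perfect E" "p \<in> gaps E" "q \<in> gaps E" "p \<noteq> q"
  shows "{fst p..snd p} \<inter> {fst q..snd q} = {}"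
proof -
  have aux: False if "(a, b) \<in> gaps E" "(b, d) \<in> gaps E" for a b d
  proof -
    have "a < b" "b < d" "b \<in> E"
      and gap: "\<And>y. y \<in> E \<Longrightarrow> \<not> (a < y \<and> y < b)" "\<And>y. y \<in> E \<Longrightarrow> \<not> (b < y \<and> y < d)"
      using that by (auto simp: gaps_def)
    then obtain y where y: "y \<in> E" "y \<noteq> b" "a < y" "y < d"
      using perfect_not_isolated[OF assms(1), of a b d] by blast
    show False
      using gap[OF y(1)] y by linarith
  qed
  obtain a b c d where p: "p = (a, b)" and q: "q = (c, d)" by fastforce
  show ?thesis
  proof (rule ccontr)
    assume "{fst p..snd p} \<inter> {fst q..snd q} \<noteq> {}"
    then obtain z where "z \<in> {a..b}" "z \<in> {c..d}" unfolding p q by (metis Int_iff all_not_in_conv fst_conv snd_conv)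
    then have z: "a \<le> z" "z \<le> b" "c \<le> z" "z \<le> d" by auto
    have "a < b" "c < d" using assms(2,3) by (auto simp: p q gaps_def)
    then consider "b \<le> c" | "d \<le> a" | "max a c < min b d" by fastforce
    then show False
    proof cases
      case 1
      then have "b = c" using z by simp
      then show False using aux assms p q by blast
    next
      case 2
      then have "d = a" using z by simp
      then show False using aux assms p q by blast
    next
      case 3
      then obtain y where "max a c < y" "y < min b d" using dense by blast
      then show False using gaps_eq[of a b E c d y] assms p q by auto
    qed
  qed
qed

text \<open>A closed nowhere dense set contains no interval, so some point between e1 and e2 is
  missing from E; the gap around it is taken.\<close>

lemma gap_between:
  assumes "closed E" "nowhere_dense E" "e1 \<in> E" "e2 \<in> E" "e1 < e2"
  obtains a b where "(a, b) \<in> gaps E" "e1 \<le> a" "b \<le> e2"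
proof -
  have "\<not> {e1<..<e2} \<subseteq> E"
  proof
    assume "{e1<..<e2} \<subseteq> E"
    then have "{e1<..<e2} \<subseteq> interior (closure E)"
      using \<open>closed E\<close> by (intro interior_maximal) auto
    then show False
      using assms unfolding nowhere_dense_def by auto
  qed
  then obtain z where "z \<notin> E" "e1 < z" "z < e2" by (metis greaterThanLessThan_iff subsetI)
  then show ?thesis
    using gap_exists[OF \<open>closed E\<close> _ assms(3,4)] that by metis
qed

text \<open>Three points of E bound two adjacent intervals, each of which will supply a gap. The
  points are x, some y near x, and some z strictly closer to x than y.\<close>

lemma perfect_three_points:
  fixes E :: "real set"
  assumes "perfect E" "x \<in> E" "r > 0"
  obtains e1 e2 e3 where "e1 \<in> E" "e2 \<in> E" "e3 \<in> E" "e1 < e2" "e2 < e3"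
    "e1 \<in> ball x r" "e3 \<in> ball x r"
proof -
  obtain y where y: "y \<in> E" "y \<noteq> x" "x - r < y" "y < x + r"
    using perfect_not_isolated[OF assms(1), of "x - r" x "x + r"] assms by auto
  define s where "s = \<bar>y - x\<bar>"
  have s: "s > 0" "s < r" using y by (auto simp: s_def)
  obtain z where z: "z \<in> E" "z \<noteq> x" "x - s < z" "z < x + s"
    using perfect_not_isolated[OF assms(1), of "x - s" x "x + s"] assms s by auto
  have "z \<noteq> y" using z by (auto simp: s_def)
  have ball: "x \<in> ball x r" "y \<in> ball x r" "z \<in> ball x r"
    using y z s by (auto simp: dist_real_def s_def)
  consider "x < y" "y < z" | "x < z" "z < y" | "y < x" "x < z" | "y < z" "z < x"
    | "z < x" "x < y" | "z < y" "y < x"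
    using \<open>z \<noteq> y\<close> z(2) y(2) by linarith
  then show ?thesis
    by cases (use that y(1) z(1) assms(2) ball in blast)+
qed

text \<open>A connected set missing E lies on one side of every point of E. Inclusion in a gap
  suffices, since a formula valid on the gap restricts to the component.\<close>

lemma component_complement_cases:
  fixes E :: "real set"
  assumes "closed E" "lo \<in> E" "hi \<in> E" "I \<in> components (UNIV - E)"
  obtains "I \<subseteq> {..<lo}" | "I \<subseteq> {hi<..}" | a b where "(a, b) \<in> gaps E" "I \<subseteq> {a<..<b}"
proof -
  have con: "connected I" using assms in_components_connected by blast
  have IE: "I \<inter> E = {}" using assms in_components_subset by blast
  obtain x where x: "x \<in> I" using assms in_components_nonempty by blast
  have below: "I \<subseteq> {..<e}" if "e \<in> E" "x < e" for e
  proof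
    fix y assume "y \<in> I"
    show "y \<in> {..<e}"
    proof (rule ccontr)
      assume "y \<notin> {..<e}"
      then have "e \<in> {x..y}" using that by auto
      then show False
        using connected_contains_Icc[OF con x \<open>y \<in> I\<close>] IE that by blast
    qed
  qed
  have above: "I \<subseteq> {e<..}" if "e \<in> E" "e < x" for e
  proof
    fix y assume "y \<in> I"
    show "y \<in> {e<..}"
    proof (rule ccontr)
      assume "y \<notin> {e<..}"
      then have "e \<in> {y..x}" using that by auto
      then show False
        using connected_contains_Icc[OF con \<open>y \<in> I\<close> x] IE that by blast
    qed
  qed
  have "x \<notin> E" using x IE by blast
  show ?thesis
  proof (cases "x < lo \<or> hi < x")
    case True
    then show ?thesis using below above assms that(1,2) by blast
  next
    case False
    then have "lo < x" "x < hi" using \<open>x \<notin> E\<close> assms by (auto simp: not_less order.strict_iff_order)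
    then obtain a b where ab: "(a, b) \<in> gaps E" "a < x" "x < b"
      using gap_exists[OF assms(1) \<open>x \<notin> E\<close> assms(2,3)] by blast
    have "I \<subseteq> {a<..}" "I \<subseteq> {..<b}" using above below ab by (auto simp: gaps_def)
    then have "I \<subseteq> {a<..<b}" by (auto simp: subset_iff)
    then show ?thesis using that(3)[OF ab(1)] by blast
  qed
qed

section \<open>Applying the construction to the gaps of the given set\<close>

theorem theorem4p6:
  fixes E F :: "real set"
  assumes "E \<noteq> {}" and "compact E" and "perfect E" and "nowhere_dense E"
    and "subfield_of_reals F" and "closure F = UNIV"
  shows "\<exists>g \<in> Cc_infinity.
           (\<forall>I \<in> components (UNIV - E). \<exists>P \<in> polys_over F. \<forall>x\<in>I. g x = poly P x) \<and>
           (\<forall>x \<in> UNIV - E. real_analytic_at g x) \<and>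
           (\<forall>x \<in> E. \<not> real_analytic_at g x) \<and>
           NA g = E"
proof -
  have "closed E" using \<open>compact E\<close> by (rule compact_imp_closed)
  obtain lo where lo: "lo \<in> E" "\<And>x. x \<in> E \<Longrightarrow> lo \<le> x"
    using compact_attains_inf[OF \<open>compact E\<close> \<open>E \<noteq> {}\<close>] by blast
  obtain hi where hi: "hi \<in> E" "\<And>x. x \<in> E \<Longrightarrow> x \<le> hi"
    using compact_attains_sup[OF \<open>compact E\<close> \<open>E \<noteq> {}\<close>] by blast
  \<comment> \<open>g is to vanish on these half-lines. No closed gap meets them: lo and hi are not
    isolated in E, so neither is an endpoint of a gap.\<close>
  define C where "C = {..lo} \<union> {hi..}"
  have C_gaps: "C \<inter> {fst p..snd p} = {}" if "p \<in> gaps E" for p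
  proof -
    obtain a b where p: "p = (a, b)" by fastforce
    then have ab: "a \<in> E" "b \<in> E" "a < b" and gap: "\<And>y. y \<in> E \<Longrightarrow> \<not> (a < y \<and> y < b)"
      using that by (auto simp: gaps_def)
    have "lo \<noteq> a"
    proof
      assume "lo = a"
      then obtain y where "y \<in> E" "y \<noteq> lo" "lo - 1 < y" "y < b"
        using perfect_not_isolated[OF \<open>perfect E\<close>, of "lo - 1" lo b] lo ab by auto
      then show False using gap[of y] lo(2)[of y] \<open>lo = a\<close> by simp
    qed
    moreover have "hi \<noteq> b"
    proof
      assume "hi = b"
      then obtain y where "y \<in> E" "y \<noteq> hi" "a < y" "y < hi + 1"
        using perfect_not_isolated[OF \<open>perfect E\<close>, of a hi "hi + 1"] hi ab by auto
      then show False using gap[of y] hi(2)[of y] \<open>hi = b\<close> by simp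
    qed
    ultimately have "lo < a" "b < hi"
      using lo(2)[OF ab(1)] hi(2)[OF ab(2)] by auto
    then show ?thesis by (auto simp: C_def p)
  qed
  have gaps_le: "fst p \<le> snd p" if "p \<in> gaps E" for p
    using that by (auto simp: gaps_def)
  have "closed C" by (auto simp: C_def)
  obtain g P where g: "smooth g" "\<And>x. x \<in> C \<Longrightarrow> g x = 0" and
    P: "inj_on P (gaps E)" "P ` gaps E \<subseteq> polys_over F"
      "\<And>p x. p \<in> gaps E \<Longrightarrow> x \<in> {fst p..snd p} \<Longrightarrow> g x = poly (P p) x"
    using smooth_polynomial_on_intervals[OF assms(5,6) \<open>closed C\<close> countable_gaps gaps_le C_gaps
        gaps_closures_disjoint[OF \<open>perfect E\<close>]] by blast
  have "g \<in> Cc_infinity"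
  proof -
    have "{x. g x \<noteq> 0} \<subseteq> - C" using g(2) by blast
    also have "\<dots> \<subseteq> {lo..hi}" by (auto simp: C_def)
    finally have "{x. g x \<noteq> 0} \<subseteq> {lo..hi}" .
    then have "bounded {x. g x \<noteq> 0}" using bounded_closed_interval bounded_subset by blast
    then show ?thesis using g(1) by (simp add: Cc_infinity_def compact_closure)
  qed
  moreover have poly: "\<exists>Q\<in>polys_over F. \<forall>x\<in>I. g x = poly Q x" if "I \<in> components (UNIV - E)" for I
  proof -
    have 0: "0 \<in> polys_over F" using assms(5) by (auto simp: polys_over_def subfield_of_reals_def)
    show ?thesis
    proof (rule component_complement_cases[OF \<open>closed E\<close> lo(1) hi(1) that])
      assume "I \<subseteq> {..<lo}"
      then show ?thesis using g(2) 0 by (intro bexI[of _ 0]) (auto simp: C_def)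
    next
      assume "I \<subseteq> {hi<..}"
      then show ?thesis using g(2) 0 by (intro bexI[of _ 0]) (auto simp: C_def)
    next
      fix a b assume ab: "(a, b) \<in> gaps E" "I \<subseteq> {a<..<b}"
      then show ?thesis using P(2) P(3)[OF ab(1)] by (intro bexI[of _ "P (a, b)"]) auto
    qed
  qed
  moreover have an: "real_analytic_at g x" if "x \<in> UNIV - E" for x
  proof -
    have "x \<in> \<Union> (components (UNIV - E))"
      unfolding Union_components using that .
    then obtain I where I: "I \<in> components (UNIV - E)" "x \<in> I" by (rule UnionE)
    have "open I"
      by (rule open_components[OF _ I(1)]) (use \<open>closed E\<close> in auto)
    obtain Q where "\<forall>x\<in>I. g x = poly Q x" using poly[OF I(1)] by blast
    then have "\<forall>\<^sub>F y in nhds x. g y = poly Q y"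
      using eventually_nhds_in_open[OF \<open>open I\<close> I(2)] by (auto elim: eventually_mono)
    then show ?thesis by (rule real_analytic_at_poly)
  qed
  moreover have not_an: "\<not> real_analytic_at g x" if "x \<in> E" for x
  proof
    assume "real_analytic_at g x"
    then obtain r where "r > 0" and ext:
      "\<And>a b p. a < b \<Longrightarrow> {a<..<b} \<subseteq> ball x r \<Longrightarrow> \<forall>y\<in>{a<..<b}. g y = poly p y \<Longrightarrow>
         \<forall>y\<in>ball x r. g y = poly p y"
      using real_analytic_at_poly_extends by blast
    \<comment> \<open>The middle point e2 separates the gap found in [e1, e2] from the one found in
      [e2, e3]; both lie in the ball.\<close>
    obtain e1 e2 e3 where e: "e1 \<in> E" "e2 \<in> E" "e3 \<in> E" "e1 < e2" "e2 < e3"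
      "e1 \<in> ball x r" "e3 \<in> ball x r"
      using perfect_three_points[OF \<open>perfect E\<close> \<open>x \<in> E\<close> \<open>r > 0\<close>] by blast
    obtain a b where ab: "(a, b) \<in> gaps E" "e1 \<le> a" "b \<le> e2"
      using gap_between[OF \<open>closed E\<close> \<open>nowhere_dense E\<close> e(1,2,4)] by blast
    obtain c d where cd: "(c, d) \<in> gaps E" "e2 \<le> c" "d \<le> e3"
      using gap_between[OF \<open>closed E\<close> \<open>nowhere_dense E\<close> e(2,3,5)] by blast
    have "a < b" "c < d" using ab cd by (auto simp: gaps_def)
    have "{a<..<b} \<subseteq> ball x r" "{c<..<d} \<subseteq> ball x r"
      using e ab cd by (auto simp: dist_real_def)
    moreover have "\<forall>y\<in>{a<..<b}. g y = poly (P (a, b)) y" "\<forall>y\<in>{c<..<d}. g y = poly (P (c, d)) y"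
      using P(3)[OF ab(1)] P(3)[OF cd(1)] by auto
    \<comment> \<open>Both polynomials equal g on the whole ball, so injectivity of P identifies the
      two gaps, although b \<le> e2 \<le> c.\<close>
    ultimately have "\<forall>y\<in>ball x r. poly (P (a, b)) y = poly (P (c, d)) y"
      using ext[OF \<open>a < b\<close>, of "P (a, b)"] ext[OF \<open>c < d\<close>, of "P (c, d)"] by auto
    then have "P (a, b) = P (c, d)"
      using \<open>r > 0\<close> by (intro poly_eq_on_open_interval[of "x - r" "x + r"]) (auto simp: dist_real_def)
    then have "(a, b) = (c, d)" using P(1) ab(1) cd(1) by (meson inj_onD)
    then show False using \<open>a < b\<close> ab cd by simp
  qed
  moreover have "NA g = E" using an not_an by (auto simp: NA_def)
  ultimately show ?thesis by blast
qed

end
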